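(* Let $n\ge 3$, and let $G$ be a graph on a vertex set $V$ with a fixed partition $V=V_1\cup V_2$, where $|V_1|=|V_2|=n$. If $G$ is balanced $K_4$-free, then $$\mathcal{N}_{\mathrm{cr}}(K_3,G)\le n\binom{n}{2}.$$
   Context: Graphs are finite and simple, and edges of $G$ may lie inside $V_1$, inside $V_2$, or between them. With respect to the fixed partition $V=V_1\cup V_2$, a balanced $K_4$ in $G$ is a complete subgraph on four vertices having exactly two vertices in $V_1$ and exactly two in $V_2$; $G$ is balanced $K_4$-free if it contains none. A crossing triangle is a triangle of $G$ containing vertices from both $V_1$ and $V_2$, and $\mathcal{N}_{\mathrm{cr}}(K_3,G)$ is the number of crossing triangles in $G$. *)

theory Defs
  imports Main
begin

definition simple_graph :: "'a set \<Rightarrow> 'a set set \<Rightarrow> bool" where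
  "simple_graph V E \<longleftrightarrow> finite V \<and> (\<forall>e\<in>E. e \<subseteq> V \<and> card e = 2)"

text \<open>Complete subgraphs are identified with their vertex sets, as a simple graph contains at
  most one complete subgraph on a given vertex set.\<close>

definition complete_on :: "'a set \<Rightarrow> 'a set set \<Rightarrow> 'a set \<Rightarrow> bool" where
  "complete_on V E S \<longleftrightarrow> S \<subseteq> V \<and> (\<forall>x\<in>S. \<forall>y\<in>S. x \<noteq> y \<longrightarrow> {x, y} \<in> E)"

definition vertex_partition :: "'a set \<Rightarrow> 'a set \<Rightarrow> 'a set \<Rightarrow> bool" where
  "vertex_partition V V1 V2 \<longleftrightarrow> V = V1 \<union> V2 \<and> V1 \<inter> V2 = {}"

definition balanced_K4 :: "'a set \<Rightarrow> 'a set set \<Rightarrow> 'a set \<Rightarrow> 'a set \<Rightarrow> 'a set \<Rightarrow> bool" where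
  "balanced_K4 V E V1 V2 S \<longleftrightarrow>
     complete_on V E S \<and> card S = 4 \<and> card (S \<inter> V1) = 2 \<and> card (S \<inter> V2) = 2"

definition balanced_K4_free :: "'a set \<Rightarrow> 'a set set \<Rightarrow> 'a set \<Rightarrow> 'a set \<Rightarrow> bool" where
  "balanced_K4_free V E V1 V2 \<longleftrightarrow> (\<nexists>S. balanced_K4 V E V1 V2 S)"

definition triangle :: "'a set \<Rightarrow> 'a set set \<Rightarrow> 'a set \<Rightarrow> bool" where
  "triangle V E T \<longleftrightarrow> complete_on V E T \<and> card T = 3"

definition crossing_triangle :: "'a set \<Rightarrow> 'a set set \<Rightarrow> 'a set \<Rightarrow> 'a set \<Rightarrow> 'a set \<Rightarrow> bool" where
  "crossing_triangle V E V1 V2 T \<longleftrightarrow> triangle V E T \<and> T \<inter> V1 \<noteq> {} \<and> T \<inter> V2 \<noteq> {}"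

definition num_crossing_triangles :: "'a set \<Rightarrow> 'a set set \<Rightarrow> 'a set \<Rightarrow> 'a set \<Rightarrow> nat" where
  "num_crossing_triangles V E V1 V2 = card {T. crossing_triangle V E V1 V2 T}"

end

theory Submission
  imports Defs
begin

text \<open>For a crossing edge \<open>ab\<close> let \<open>p\<close> and \<open>q\<close> be the numbers of its common neighbours in
  \<open>V\<^sub>1\<close> and in \<open>V\<^sub>2\<close>. Every crossing triangle contains exactly two crossing edges, so the
  \<open>p + q\<close> sum to twice the number of crossing triangles. As \<open>p, q \<le> n - 1\<close>, we have
  \<open>(n - 1) (p + q) \<le> (n - 1)\<^sup>2 + p q\<close>. Balanced \<open>K\<^sub>4\<close>-freeness makes each of the \<open>p q\<close> pairs
  of common neighbours a crossing non-edge, and a crossing non-edge \<open>xy\<close> arises in this way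
  from at most \<open>(n - 1)\<^sup>2\<close> pairs \<open>ab\<close>, because \<open>a \<noteq> x\<close> and \<open>b \<noteq> y\<close>. Hence each of the \<open>n\<^sup>2\<close>
  crossing pairs, edge or not, contributes at most \<open>(n - 1)\<^sup>2\<close>.\<close>

definition common_nbrs :: "'a set set \<Rightarrow> 'a set \<Rightarrow> 'a \<Rightarrow> 'a \<Rightarrow> 'a set" where
  "common_nbrs E U a b = {x \<in> U. {a, x} \<in> E \<and> {b, x} \<in> E}"

text \<open>Ordered pairs with the \<open>U\<close> endpoint first: for disjoint \<open>U\<close>
  and \<open>W\<close> each crossing edge appears exactly once, and the complement in
  \<open>U \<times> W\<close> consists of the crossing non-edges.\<close>

definition crossing_edges :: "'a set set \<Rightarrow> 'a set \<Rightarrow> 'a set \<Rightarrow> ('a \<times> 'a) set" where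
  "crossing_edges E U W = {(a, b) \<in> U \<times> W. {a, b} \<in> E}"

lemma finite_common_nbrs: "finite U \<Longrightarrow> finite (common_nbrs E U a b)"
  by (simp add: common_nbrs_def)

lemma finite_crossing_edges: "finite U \<Longrightarrow> finite W \<Longrightarrow> finite (crossing_edges E U W)"
  by (rule finite_subset[of _ "U \<times> W"]) (auto simp: crossing_edges_def)

lemma simple_graph_neq: "simple_graph V E \<Longrightarrow> {x, y} \<in> E \<Longrightarrow> x \<noteq> y"
  unfolding simple_graph_def by fastforce

text \<open>Take \<open>u\<close> in \<open>V1\<close> and \<open>v\<close> in \<open>V2\<close>.
  The third vertex \<open>w\<close> lies on one side and is joined to whichever of \<open>u\<close>,
  \<open>v\<close> lies on the other, which gives a second crossing edge.\<close>

lemma crossing_triangle_two_crossing_edges: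
  assumes part: "vertex_partition V V1 V2" and fin: "finite V1" "finite V2"
    and T: "crossing_triangle V E V1 V2 T"
  shows "2 \<le> card {e \<in> crossing_edges E V1 V2. fst e \<in> T \<and> snd e \<in> T}"
    (is "2 \<le> card ?S")
proof -
  have comp: "complete_on V E T" and "card T = 3"
    using T by (auto simp: crossing_triangle_def triangle_def)
  obtain u v where u: "u \<in> T" "u \<in> V1" and v: "v \<in> T" "v \<in> V2"
    using T by (auto simp: crossing_triangle_def)
  have "\<not> T \<subseteq> {u, v}"
    using \<open>card T = 3\<close> card_mono[of "{u, v}" T] by (auto simp: card_insert_if split: if_splits)
  then obtain w where w: "w \<in> T" "w \<noteq> u" "w \<noteq> v" by auto
  have edge: "(x, y) \<in> ?S" if "x \<in> T" "y \<in> T" "x \<in> V1" "y \<in> V2" for x y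
  proof -
    have "x \<noteq> y" using that part by (auto simp: vertex_partition_def)
    then show ?thesis using that comp by (simp add: complete_on_def crossing_edges_def)
  qed
  obtain e where e: "e \<in> ?S" "e \<noteq> (u, v)"
  proof (cases "w \<in> V1")
    case True
    then show ?thesis using edge[of w v] w v that by auto
  next
    case False
    then have "w \<in> V2"
      using w comp part by (auto simp: complete_on_def vertex_partition_def)
    then show ?thesis using edge[of u w] w u that by auto
  qed
  have "finite ?S" using fin by (simp add: finite_crossing_edges)
  moreover have "{(u, v), e} \<subseteq> ?S" using edge[of u v] u v e by auto
  ultimately have "card {(u, v), e} \<le> card ?S" by (rule card_mono)
  then show ?thesis using e by simp
qed

text \<open>A triangle through \<open>a\<close> and \<open>b\<close> is determined by its third
  vertex, a common neighbour on one of the two sides.\<close>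

lemma card_crossing_triangles_through:
  assumes part: "vertex_partition V V1 V2" and fin: "finite V1" "finite V2"
    and ab: "a \<in> V1" "b \<in> V2"
  shows "card {T. crossing_triangle V E V1 V2 T \<and> a \<in> T \<and> b \<in> T}
    \<le> card (common_nbrs E V1 a b) + card (common_nbrs E V2 a b)"
    (is "card ?S \<le> card ?P + card ?Q")
proof -
  have fin': "finite (?P \<union> ?Q)" using fin by (simp add: finite_common_nbrs)
  have "?S \<subseteq> (\<lambda>x. {a, b, x}) ` (?P \<union> ?Q)"
  proof
    fix T assume "T \<in> ?S"
    then have comp: "complete_on V E T" and card: "card T = 3" and abT: "a \<in> T" "b \<in> T"
      by (auto simp: crossing_triangle_def triangle_def)
    have "a \<noteq> b" using ab part by (auto simp: vertex_partition_def)
    have "finite T" using card by (metis card.infinite zero_neq_numeral)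
    then have "card (T - {a, b}) = 1"
      using card abT \<open>a \<noteq> b\<close> by (simp add: card_Diff_subset)
    then obtain x where x: "T - {a, b} = {x}" by (auto simp: card_1_singleton_iff)
    then have "T = {a, b, x}" and "x \<in> T" "x \<noteq> a" "x \<noteq> b" using abT by auto
    moreover have "x \<in> ?P \<union> ?Q"
      using comp abT part \<open>x \<in> T\<close> \<open>x \<noteq> a\<close> \<open>x \<noteq> b\<close>
      by (auto simp: complete_on_def common_nbrs_def vertex_partition_def)
    ultimately show "T \<in> (\<lambda>x. {a, b, x}) ` (?P \<union> ?Q)" by blast
  qed
  then have "card ?S \<le> card (?P \<union> ?Q)" by (rule surj_card_le[OF fin'])
  also have "\<dots> \<le> card ?P + card ?Q" by (rule card_Un_le)
  finally show ?thesis .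
qed

lemma twice_num_crossing_triangles_le:
  assumes part: "vertex_partition V V1 V2" and fin: "finite V1" "finite V2"
  shows "2 * num_crossing_triangles V E V1 V2
    \<le> (\<Sum>(a, b)\<in>crossing_edges E V1 V2.
          card (common_nbrs E V1 a b) + card (common_nbrs E V2 a b))"
proof -
  let ?T = "{T. crossing_triangle V E V1 V2 T}" and ?C = "crossing_edges E V1 V2"
  have "?T \<subseteq> Pow (V1 \<union> V2)"
    using part by (auto simp: crossing_triangle_def triangle_def complete_on_def
        vertex_partition_def)
  then have finT: "finite ?T" using fin by (meson finite_Pow_iff finite_UnI finite_subset)
  have "2 * card ?T = (\<Sum>T\<in>?T. 2)" by simp
  also have "\<dots> \<le> (\<Sum>T\<in>?T. card {e \<in> ?C. fst e \<in> T \<and> snd e \<in> T})"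
    using crossing_triangle_two_crossing_edges[OF part fin] by (intro sum_mono) simp
  also have "\<dots> = (\<Sum>T\<in>?T. \<Sum>e | e \<in> ?C \<and> fst e \<in> T \<and> snd e \<in> T. 1)" by simp
  \<comment> \<open>Double counting of the pairs of a crossing triangle and a crossing edge inside
    it.\<close>
  also have "\<dots> = (\<Sum>e\<in>?C. \<Sum>T | T \<in> ?T \<and> fst e \<in> T \<and> snd e \<in> T. 1)"
    using finT finite_crossing_edges[OF fin] by (rule sum.swap_restrict)
  also have "\<dots> = (\<Sum>(a, b)\<in>?C. card {T. crossing_triangle V E V1 V2 T \<and> a \<in> T \<and> b \<in> T})"
    by (simp add: case_prod_beta)
  also have "\<dots> \<le> (\<Sum>(a, b)\<in>?C. card (common_nbrs E V1 a b) + card (common_nbrs E V2 a b))"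
    using card_crossing_triangles_through[OF part fin]
    by (intro sum_mono) (auto simp: crossing_edges_def)
  finally show ?thesis by (simp add: num_crossing_triangles_def)
qed

text \<open>Without loops, an endpoint lying in \<open>U\<close> is not its own neighbour. A
  crossing edge has an endpoint on each side, so the bound serves for both \<open>V1\<close> and
  \<open>V2\<close>.\<close>

lemma card_common_nbrs_le:
  assumes "simple_graph V E" "finite U" "a \<in> U \<or> b \<in> U"
  shows "card (common_nbrs E U a b) \<le> card U - 1"
proof -
  obtain c where c: "c \<in> {a, b}" "c \<in> U" using assms(3) by auto
  have "common_nbrs E U a b \<subseteq> U - {c}"
    using c simple_graph_neq[OF assms(1)] by (auto simp: common_nbrs_def)
  then have "card (common_nbrs E U a b) \<le> card (U - {c})"
    using assms(2) by (intro card_mono) auto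
  then show ?thesis using assms(2) c by simp
qed

text \<open>The other five edges on \<open>a\<close>, \<open>x\<close>, \<open>b\<close>,
  \<open>y\<close> are present already, so \<open>{x, y}\<close> would complete a balanced
  \<open>K4\<close>.\<close>

lemma common_nbrs_not_adjacent:
  assumes sg: "simple_graph V E" and part: "vertex_partition V V1 V2"
    and free: "balanced_K4_free V E V1 V2"
    and ab: "(a, b) \<in> crossing_edges E V1 V2"
    and x: "x \<in> common_nbrs E V1 a b" and y: "y \<in> common_nbrs E V2 a b"
  shows "{x, y} \<notin> E"
proof
  assume xy: "{x, y} \<in> E"
  let ?S = "{a, x, b, y}"
  have mem: "a \<in> V1" "x \<in> V1" "b \<in> V2" "y \<in> V2"
    and edges: "{a, b} \<in> E" "{a, x} \<in> E" "{b, x} \<in> E" "{a, y} \<in> E" "{b, y} \<in> E"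
    using ab x y by (auto simp: common_nbrs_def crossing_edges_def)
  have disj: "V1 \<inter> V2 = {}" and V: "V = V1 \<union> V2"
    using part by (auto simp: vertex_partition_def)
  have "a \<noteq> x" "b \<noteq> y" using edges simple_graph_neq[OF sg] by blast+
  moreover have "a \<noteq> b" "a \<noteq> y" "x \<noteq> b" "x \<noteq> y" using mem disj by auto
  moreover have "?S \<inter> V1 = {a, x}" "?S \<inter> V2 = {b, y}" using mem disj by auto
  moreover have "complete_on V E ?S"
    using mem edges xy V by (auto simp: complete_on_def insert_commute)
  ultimately have "balanced_K4 V E V1 V2 ?S" by (simp add: balanced_K4_def)
  then show False using free by (auto simp: balanced_K4_free_def)
qed

lemma sum_common_nbrs_prod_le:
  assumes sg: "simple_graph V E" and part: "vertex_partition V V1 V2"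
    and free: "balanced_K4_free V E V1 V2"
    and fin: "finite V1" "finite V2"
  shows "(\<Sum>(a, b)\<in>crossing_edges E V1 V2.
            card (common_nbrs E V1 a b) * card (common_nbrs E V2 a b))
    \<le> card (V1 \<times> V2 - crossing_edges E V1 V2) * ((card V1 - 1) * (card V2 - 1))"
proof -
  let ?C = "crossing_edges E V1 V2"
  \<comment> \<open>\<open>?L\<close> collects the pairs (\<open>ab\<close>, \<open>xy\<close>)
    grouped by the edge \<open>ab\<close>. Swapping the components regroups them by the non-edge
    \<open>xy\<close>, and \<open>?R\<close> keeps only the constraints \<open>a \<noteq> x\<close>
    and \<open>b \<noteq> y\<close>.\<close>
  let ?L = "SIGMA e:?C. common_nbrs E V1 (fst e) (snd e) \<times> common_nbrs E V2 (fst e) (snd e)"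
  let ?R = "SIGMA f:V1 \<times> V2 - ?C. (V1 - {fst f}) \<times> (V2 - {snd f})"
  have "(\<Sum>(a, b)\<in>?C. card (common_nbrs E V1 a b) * card (common_nbrs E V2 a b)) = card ?L"
    using fin by (simp add: card_SigmaI finite_crossing_edges finite_common_nbrs
        card_cartesian_product case_prod_beta)
  also have "card ?L \<le> card ?R"
  proof (rule card_inj_on_le)
    show "inj_on prod.swap ?L" by (rule inj_on_subset[OF inj_swap subset_UNIV])
    show "prod.swap ` ?L \<subseteq> ?R"
    proof
      fix z assume "z \<in> prod.swap ` ?L"
      then obtain a b x y where z: "z = ((x, y), (a, b))" and ab: "(a, b) \<in> ?C"
        and x: "x \<in> common_nbrs E V1 a b" and y: "y \<in> common_nbrs E V2 a b"
        by auto
      have "{x, y} \<notin> E" by (rule common_nbrs_not_adjacent[OF sg part free ab x y])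
      moreover have "a \<noteq> x" "b \<noteq> y"
        using x y simple_graph_neq[OF sg] by (auto simp: common_nbrs_def)
      ultimately show "z \<in> ?R"
        using z ab x y by (auto simp: common_nbrs_def crossing_edges_def)
    qed
    show "finite ?R" using fin by auto
  qed
  also have "card ?R = (\<Sum>f\<in>V1 \<times> V2 - ?C. card ((V1 - {fst f}) \<times> (V2 - {snd f})))"
    using fin by (intro card_SigmaI) auto
  also have "\<dots> = (\<Sum>f\<in>V1 \<times> V2 - ?C. (card V1 - 1) * (card V2 - 1))"
    using fin by (intro sum.cong) (auto simp: card_cartesian_product)
  finally show ?thesis by simp
qed

theorem theorem2p5:
  fixes V V1 V2 :: "'a set" and E :: "'a set set" and n :: nat
  assumes "n \<ge> 3"
    and "simple_graph V E"
    and "vertex_partition V V1 V2"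
    and "card V1 = n" and "card V2 = n"
    and "balanced_K4_free V E V1 V2"
  shows "num_crossing_triangles V E V1 V2 \<le> n * (n choose 2)"
proof -
  let ?C = "crossing_edges E V1 V2" and ?t = "num_crossing_triangles V E V1 V2"
  let ?p = "\<lambda>e. card (common_nbrs E V1 (fst e) (snd e))"
  let ?q = "\<lambda>e. card (common_nbrs E V2 (fst e) (snd e))"
  define k where "k = n - 1"
  have fin: "finite V1" "finite V2" using assms(2,3)
    by (auto simp: simple_graph_def vertex_partition_def)
  \<comment> \<open>This is \<open>(k - p) * (k - q) \<ge> 0\<close> expanded; with
    \<open>k = p + c\<close> it reduces to \<open>c * q \<le> c * k\<close>.\<close>
  have ineq: "k * (p + q) \<le> k * k + p * q" if pq: "p \<le> k" "q \<le> k" for p q :: nat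
  proof -
    obtain c where "k = p + c" using pq(1) le_Suc_ex by blast
    then show ?thesis using mult_le_mono2[OF pq(2), of c] by (simp add: algebra_simps)
  qed
  have bound: "k * (?p e + ?q e) \<le> k * k + ?p e * ?q e" if "e \<in> ?C" for e
    using that assms(2,4,5) fin
    by (intro ineq) (auto simp: k_def crossing_edges_def
        dest: card_common_nbrs_le[of V E V1 "fst e" "snd e"]
          card_common_nbrs_le[of V E V2 "fst e" "snd e"])
  have "k * (2 * ?t) \<le> k * (\<Sum>e\<in>?C. ?p e + ?q e)"
    using twice_num_crossing_triangles_le[OF assms(3) fin, of E] by (simp add: case_prod_beta)
  also have "\<dots> = (\<Sum>e\<in>?C. k * (?p e + ?q e))" by (rule sum_distrib_left)
  also have "\<dots> \<le> (\<Sum>e\<in>?C. k * k + ?p e * ?q e)" using bound by (rule sum_mono)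
  also have "\<dots> = card ?C * (k * k) + (\<Sum>e\<in>?C. ?p e * ?q e)" by (simp add: sum.distrib)
  also have "\<dots> \<le> card ?C * (k * k) + card (V1 \<times> V2 - ?C) * (k * k)"
    using sum_common_nbrs_prod_le[OF assms(2,3,6) fin] assms(4,5)
    by (simp add: case_prod_beta k_def)
  also have "\<dots> = card (V1 \<times> V2) * (k * k)"
  proof -
    have "?C \<subseteq> V1 \<times> V2" by (auto simp: crossing_edges_def)
    then have "card ?C + card (V1 \<times> V2 - ?C) = card (V1 \<times> V2)"
      using fin card_mono[of "V1 \<times> V2" ?C]
      by (simp add: card_Diff_subset finite_crossing_edges)
    then show ?thesis by (simp flip: add_mult_distrib)
  qed
  also have "\<dots> = k * (n * (n * k))" using assms(4,5) by (simp add: card_cartesian_product)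
  \<comment> \<open>Cancelling the factor \<open>k\<close> uses \<open>k > 0\<close>, which follows
    from \<open>n \<ge> 3\<close>.\<close>
  finally have "2 * ?t \<le> n * (n * k)" using assms(1) by (simp add: k_def)
  \<comment> \<open>The halving in \<open>choose_two\<close> is exact because
    \<open>n * (n - 1)\<close> is even.\<close>
  also have "n * k = 2 * (n choose 2)"
    unfolding k_def choose_two by (rule dvd_mult_div_cancel[symmetric]) auto
  finally show ?thesis by simp
qed

end
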